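(* Let $\mathcal X\subseteq\mathbb R^n$ be a compact set, let $p>0$, and consider the problem $\min f(x)$ subject to $x\in\Omega=\{x\in\mathbb R^n\mid x\ge0\}$. With the definitions Def1–Def5 of $(\epsilon,p)$-2o points and the relations $\gtrsim$ and $\approx$ (on $\mathcal X$) given in the context, the following hold: (1) $\text{Def2}\gtrsim\text{Def3}$; (2) $\text{Def3}\approx\text{Def4}$; (3) $\text{Def4}\gtrsim\text{Def5}$; (4) $\text{Def1}\gtrsim\text{Def5}$.
   Context: $f:\mathbb R^n\to\mathbb R$ is twice continuously differentiable and bounded below on $\Omega=\{x\in\mathbb R^n\mid x^i\ge 0,\ i=1,\dots,n\}$. Superscripts denote components, $\|\cdot\|$ is the 2-norm, $\mathbf 1$ is the all-ones vector, $X=\mathrm{diag}(x)$, $\bar X=\mathrm{diag}(\min\{x,\mathbf 1\})$ (componentwise minimum). Throughout $\epsilon,p>0$. Five definitions of "$x$ is an $(\epsilon,p)$-2o point": Def1: $x\in\Omega$ and, with $J^+=\{i\mid0\le x^i\le\sqrt\epsilon\}$, $J^-=\{1,\dots,n\}\setminus J^+$, $S=\mathrm{diag}(s)$, $s^i=1$ for $i\in J^-$, $s^i=x^i$ for $i\in J^+$: $\|S\nabla f(x)\|\le2\epsilon$, $\nabla_if(x)\ge-\epsilon^{3/4}$ for all $i\in J^+$, and $S\nabla^2f(x)S\succeq-\epsilon^pI$. Def2: $x\ge0$ and, for a user-defined constant $\Delta_{\max}>0$ independent of $x$ and $\epsilon$, there exists $\Delta\in(0,\Delta_{\max}]$ such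 that $$\Big|\min_{x+d\in\Omega,\ \|d\|\le\Delta}\nabla f(x)^Td\Big|\le\Delta\epsilon,\qquad\Big|\min_{x+d\in\Omega,\ \|d\|\le\Delta}\nabla f(x)^Td+\tfrac12d^T\nabla^2f(x)d\Big|\le\Delta^2\epsilon^p$$ (global minima over $d$). Def3: $x\ge0$, $\nabla f(x)\ge-\epsilon\mathbf 1$, $\|X\nabla f(x)\|_\infty\le\epsilon$, $X\nabla^2f(x)X\succeq-\epsilon^pI_n$. Def4: $x\ge0$, $\nabla f(x)\ge-\epsilon\mathbf 1$, $\|\bar X\nabla f(x)\|_\infty\le\epsilon$, $\bar X\nabla^2f(x)\bar X\succeq-\epsilon^pI_n$. Def5: $x\ge0$, $\|X\nabla f(x)\|_\infty\le\epsilon$, $X\nabla^2f(x)X\succeq-\epsilon^pI_n$. Relations: DefA is essentially stronger than DefB on $\mathcal X$, written $\text{DefA}\gtrsim\text{DefB}$, if, for every sufficiently small $\epsilon\in(0,1]$, every $x\in\mathcal X$ that is an $(\epsilon,p)$-2o point by DefA is also a $(c\epsilon,p)$-2o point by DefB, where $c>0$ is a constant independent of $\epsilon$ and $x$. (That is, there exist $\bar\epsilon\in(0,1]$ and $c>0$ such that this holds for all $\epsilon\in(0,\bar\epsilon]$ and all $x\in\mathcal X$.) $\text{DefA}\approx\text{DefB}$ means both $\text{DefA}\gtrsim\text{DefB}$ and $\text{DefB}\gtrsim\text{DefA}$. *)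

theory Defs
  imports "HOL-Analysis.Analysis"
begin

definition nonneg_orthant :: "(real ^ 'n) set"
  where "nonneg_orthant = {x. \<forall>i. 0 \<le> x $ i}"

definition gradient :: "(real ^ 'n \<Rightarrow> real) \<Rightarrow> real ^ 'n \<Rightarrow> real ^ 'n"
  where "gradient f x = (\<chi> i. frechet_derivative f (at x) (axis i 1))"

definition hessian :: "(real ^ 'n \<Rightarrow> real) \<Rightarrow> real ^ 'n \<Rightarrow> real ^ 'n ^ 'n"
  where "hessian f x = jacobian (gradient f) (at x)"

definition C2 :: "(real ^ 'n \<Rightarrow> real) \<Rightarrow> bool"
  where "C2 f \<longleftrightarrow>
    (\<forall>x. f differentiable (at x)) \<and>
    (\<forall>x. gradient f differentiable (at x)) \<and>
    continuous_on UNIV (hessian f)"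

lemma gradient_GDERIV:
  assumes "f differentiable (at x)"
  shows "GDERIV f x :> gradient f x"
proof -
  let ?D = "frechet_derivative f (at x)"
  have D: "(f has_derivative ?D) (at x)"
    using assms by (simp add: frechet_derivative_works)
  have lin: "linear ?D"
    using D by (rule has_derivative_linear)
  have "?D h = h \<bullet> gradient f x" for h
  proof -
    have "?D h = ?D (\<Sum>i\<in>UNIV. h $ i *\<^sub>R axis i 1)"
      using basis_expansion[of h] by (simp add: scalar_mult_eq_scaleR)
    also have "\<dots> = h \<bullet> gradient f x"
      using lin by (simp add: linear_sum linear_scale inner_vec_def gradient_def)
    finally show ?thesis .
  qed
  then have "?D = (\<lambda>h. h \<bullet> gradient f x)" by blast
  with D show ?thesis unfolding gderiv_def by simp
qed

lemma hessian_has_derivative: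
  assumes "gradient f differentiable (at x)"
  shows "(gradient f has_derivative (\<lambda>h. hessian f x *v h)) (at x)"
  using assms jacobian_works unfolding hessian_def by blast

definition diag :: "real ^ 'n \<Rightarrow> real ^ 'n ^ 'n"
  where "diag v = (\<chi> i j. if i = j then v $ i else 0)"

text \<open>
  The Loewner order \<open>A \<succeq> B\<close>. Symmetry is not part of the definition: below it is only
  applied to \<open>D ** hessian f x ** D\<close> with \<open>D\<close> diagonal and to multiples of the identity,
  and the Hessian of a \<open>C2\<close> function is symmetric.
\<close>
definition loewner_ge :: "real ^ 'n ^ 'n \<Rightarrow> real ^ 'n ^ 'n \<Rightarrow> bool"  (infix "\<succeq>" 50)
  where "A \<succeq> B \<longleftrightarrow> (\<forall>v. 0 \<le> v \<bullet> ((A - B) *v v))"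

definition min_value :: "'a set \<Rightarrow> ('a \<Rightarrow> real) \<Rightarrow> real"
  where "min_value D q = (LEAST v. v \<in> q ` D)"

lemma min_value_attained:
  fixes q :: "'a::topological_space \<Rightarrow> real"
  assumes "compact D" "D \<noteq> {}" "continuous_on D q"
  shows "\<exists>d\<in>D. min_value D q = q d \<and> (\<forall>e\<in>D. q d \<le> q e)"
proof -
  obtain d where d: "d \<in> D" "\<forall>e\<in>D. q d \<le> q e"
    using continuous_attains_inf[OF assms] by blast
  have "min_value D q = q d"
    unfolding min_value_def by (rule Least_equality) (use d in auto)
  with d show ?thesis by blast
qed

text \<open>
  For \<open>x\<close> in the orthant and \<open>\<Delta> \<ge> 0\<close> this set is compact and contains \<open>0\<close>, so continuous
  functions attain their minimum on it.
\<close>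
definition feasible_steps :: "real ^ 'n \<Rightarrow> real \<Rightarrow> (real ^ 'n) set"
  where "feasible_steps x \<Delta> = {d. x + d \<in> nonneg_orthant \<and> norm d \<le> \<Delta>}"

definition small_coords :: "real \<Rightarrow> real ^ 'n \<Rightarrow> 'n set"
  where "small_coords \<epsilon> x = {i. 0 \<le> x $ i \<and> x $ i \<le> sqrt \<epsilon>}"

definition scaling1 :: "real \<Rightarrow> real ^ 'n \<Rightarrow> real ^ 'n ^ 'n"
  where "scaling1 \<epsilon> x = diag (\<chi> i. if i \<in> small_coords \<epsilon> x then x $ i else 1)"

definition Def1 :: "(real ^ 'n \<Rightarrow> real) \<Rightarrow> real \<Rightarrow> real \<Rightarrow> real ^ 'n \<Rightarrow> bool"
  where "Def1 f \<epsilon> p x \<longleftrightarrow>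
    x \<in> nonneg_orthant \<and>
    norm (scaling1 \<epsilon> x *v gradient f x) \<le> 2 * \<epsilon> \<and>
    (\<forall>i \<in> small_coords \<epsilon> x. gradient f x $ i \<ge> - (\<epsilon> powr (3/4))) \<and>
    scaling1 \<epsilon> x ** hessian f x ** scaling1 \<epsilon> x \<succeq> mat (- (\<epsilon> powr p))"

definition Def2 :: "real \<Rightarrow> (real ^ 'n \<Rightarrow> real) \<Rightarrow> real \<Rightarrow> real \<Rightarrow> real ^ 'n \<Rightarrow> bool"
  where "Def2 \<Delta>max f \<epsilon> p x \<longleftrightarrow>
    x \<in> nonneg_orthant \<and>
    (\<exists>\<Delta>. 0 < \<Delta> \<and> \<Delta> \<le> \<Delta>max \<and>
      \<bar>min_value (feasible_steps x \<Delta>) (\<lambda>d. gradient f x \<bullet> d)\<bar> \<le> \<Delta> * \<epsilon> \<and>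
      \<bar>min_value (feasible_steps x \<Delta>)
         (\<lambda>d. gradient f x \<bullet> d + 1/2 * (d \<bullet> (hessian f x *v d)))\<bar> \<le> \<Delta>\<^sup>2 * \<epsilon> powr p)"

definition Def3 :: "(real ^ 'n \<Rightarrow> real) \<Rightarrow> real \<Rightarrow> real \<Rightarrow> real ^ 'n \<Rightarrow> bool"
  where "Def3 f \<epsilon> p x \<longleftrightarrow>
    x \<in> nonneg_orthant \<and>
    (\<forall>i. gradient f x $ i \<ge> - \<epsilon>) \<and>
    infnorm (diag x *v gradient f x) \<le> \<epsilon> \<and>
    diag x ** hessian f x ** diag x \<succeq> mat (- (\<epsilon> powr p))"

definition capped :: "real ^ 'n \<Rightarrow> real ^ 'n"
  where "capped x = (\<chi> i. min (x $ i) 1)"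

definition Def4 :: "(real ^ 'n \<Rightarrow> real) \<Rightarrow> real \<Rightarrow> real \<Rightarrow> real ^ 'n \<Rightarrow> bool"
  where "Def4 f \<epsilon> p x \<longleftrightarrow>
    x \<in> nonneg_orthant \<and>
    (\<forall>i. gradient f x $ i \<ge> - \<epsilon>) \<and>
    infnorm (diag (capped x) *v gradient f x) \<le> \<epsilon> \<and>
    diag (capped x) ** hessian f x ** diag (capped x) \<succeq> mat (- (\<epsilon> powr p))"

definition Def5 :: "(real ^ 'n \<Rightarrow> real) \<Rightarrow> real \<Rightarrow> real \<Rightarrow> real ^ 'n \<Rightarrow> bool"
  where "Def5 f \<epsilon> p x \<longleftrightarrow>
    x \<in> nonneg_orthant \<and>
    infnorm (diag x *v gradient f x) \<le> \<epsilon> \<and>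
    diag x ** hessian f x ** diag x \<succeq> mat (- (\<epsilon> powr p))"

text \<open>
  In the next two definitions \<open>A \<epsilon> p x\<close> stands for ``\<open>x\<close> is an \<open>(\<epsilon>, p)\<close>-2o point''.
\<close>
definition ess_stronger ::
  "(real ^ 'n) set \<Rightarrow> real \<Rightarrow> (real \<Rightarrow> real \<Rightarrow> real ^ 'n \<Rightarrow> bool) \<Rightarrow>
   (real \<Rightarrow> real \<Rightarrow> real ^ 'n \<Rightarrow> bool) \<Rightarrow> bool"
  where "ess_stronger \<X> p A B \<longleftrightarrow>
    (\<exists>\<epsilon>bar c. 0 < \<epsilon>bar \<and> \<epsilon>bar \<le> 1 \<and> 0 < c \<and>
      (\<forall>\<epsilon> x. 0 < \<epsilon> \<and> \<epsilon> \<le> \<epsilon>bar \<and> x \<in> \<X> \<and> A \<epsilon> p x \<longrightarrow> B (c * \<epsilon>) p x))"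

definition ess_equivalent ::
  "(real ^ 'n) set \<Rightarrow> real \<Rightarrow> (real \<Rightarrow> real \<Rightarrow> real ^ 'n \<Rightarrow> bool) \<Rightarrow>
   (real \<Rightarrow> real \<Rightarrow> real ^ 'n \<Rightarrow> bool) \<Rightarrow> bool"
  where "ess_equivalent \<X> p A B \<longleftrightarrow> ess_stronger \<X> p A B \<and> ess_stronger \<X> p B A"

end

theory Submission
  imports Defs
begin

text \<open>
  On the compact set all coordinates are bounded by some \<open>M \<ge> 1\<close>, and every constant is built
  from \<open>M\<close>, \<open>\<Delta>max\<close> and \<open>p\<close>.

  Apart from the lower bounds on the gradient entries, the definitions other than \<open>Def2\<close> differ
  essentially in the diagonal matrix that scales the gradient and the Hessian. If the diagonals are
  related by \<open>b = a * s\<close> with \<open>\<bar>s\<bar> \<le> K\<close>, then substituting \<open>diag s *v v\<close> for \<open>v\<close> in the quadratic form of \<open>diag a ** H ** diag a\<close> weakens a curvature bound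
  \<open>-r\<close> by at most the factor \<open>K\<^sup>2\<close> (\<open>curvature_rescale\<close>), and a gradient bound by at most \<open>K\<close>.
  The capped diagonal is \<open>x\<close> times a factor at most \<open>1\<close>; conversely \<open>x\<close> is the capped diagonal, or
  the diagonal of \<open>Def1\<close>, times a factor at most \<open>M\<close>. Since the tolerance for the curvature is
  \<open>\<epsilon> powr p\<close>, a factor \<open>B\<close> there is absorbed by multiplying \<open>\<epsilon>\<close> by \<open>B powr (1 / p)\<close>
  (\<open>tolerance_factor\<close>). The passage from \<open>Def4\<close> to \<open>Def5\<close> goes through \<open>Def3\<close>, which contains all
  conditions of \<open>Def5\<close>.

  \<open>Def2\<close> is exploited by evaluating the two models at well-chosen feasible steps. The step of
  length \<open>\<Delta>\<close> along a coordinate axis bounds the gradient from below; the longest feasible step back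
  along that axis, of length \<open>min (x $ i) \<Delta>\<close>, bounds \<open>x $ i * gradient f x $ i\<close> from above. For the
  curvature along a unit vector \<open>v\<close> the step is \<open>\<plusminus>t *\<^sub>R (diag x *v v)\<close>, which stays in the
  orthant for \<open>t \<le> 1\<close> and is short enough for \<open>t \<le> \<Delta> / M\<close>. The quadratic form does not see
  the sign, so it can be chosen to make the linear term nonpositive, and then the bound on the
  quadratic model is a bound on the curvature alone (\<open>quadratic_model_curvature\<close>).
\<close>

section \<open>Diagonal scalings\<close>

lemma diag_mult_vec_nth [simp]: "(diag a *v v) $ i = a $ i * v $ i"
proof -
  have "(diag a *v v) $ i = (\<Sum>j\<in>UNIV. if i = j then a $ i * v $ j else 0)"
    by (simp add: matrix_vector_mult_def diag_def if_distrib[of "\<lambda>z. z * _"] cong: if_cong)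
  then show ?thesis by simp
qed

lemma inner_diag_mult_vec: "u \<bullet> (diag a *v w) = (diag a *v u) \<bullet> w"
  by (simp add: inner_vec_def mult_ac)

lemma scaled_loewner_ge_iff:
  "diag a ** H ** diag a \<succeq> mat (- r) \<longleftrightarrow>
     (\<forall>v. - r * (v \<bullet> v) \<le> (diag a *v v) \<bullet> (H *v (diag a *v v)))"
proof -
  have m: "mat (- r) *v v = (- r) *\<^sub>R v" for v :: "real ^ 'n"
    by (simp add: vec_eq_iff matrix_vector_mult_def mat_def if_distrib[of "\<lambda>z. z * _"] cong: if_cong)
  have "v \<bullet> ((diag a ** H ** diag a - mat (- r)) *v v)
      = (diag a *v v) \<bullet> (H *v (diag a *v v)) + r * (v \<bullet> v)" for v
    by (simp add: matrix_vector_mult_diff_rdistrib m inner_add_right inner_diff_right inner_diag_mult_vec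
        flip: matrix_vector_mul_assoc)
  then show ?thesis
    unfolding loewner_ge_def by (smt (verit) mult_minus_left)
qed

lemma norm_diag_mult_vec_le:
  assumes "\<And>i. \<bar>s $ i\<bar> \<le> K"
  shows "norm (diag s *v v) \<le> K * norm v"
proof -
  have "0 \<le> K" using assms abs_ge_zero order_trans by blast
  have "norm (diag s *v v) \<le> norm (K *\<^sub>R v)"
  proof (rule norm_le_componentwise_cart)
    fix i
    show "norm ((diag s *v v) $ i) \<le> norm ((K *\<^sub>R v) $ i)"
      using assms[of i] \<open>0 \<le> K\<close> by (simp add: abs_mult mult_right_mono)
  qed
  then show ?thesis using \<open>0 \<le> K\<close> by simp
qed

text \<open>
  Here \<open>diag b *v v = diag a *v (diag s *v v)\<close>, and \<open>diag s\<close> expands lengths by at most \<open>K\<close>.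
\<close>
lemma curvature_rescale:
  assumes H: "diag a ** H ** diag a \<succeq> mat (- r)"
    and b: "\<And>i. b $ i = a $ i * s $ i"
    and s: "\<And>i. \<bar>s $ i\<bar> \<le> K"
    and r: "0 \<le> r" "K\<^sup>2 * r \<le> r'"
  shows "diag b ** H ** diag b \<succeq> mat (- r')"
  unfolding scaled_loewner_ge_iff
proof
  fix v
  let ?w = "diag s *v v"
  have w: "diag b *v v = diag a *v ?w"
    by (simp add: vec_eq_iff b mult_ac)
  have "norm ?w ^ 2 \<le> (K * norm v) ^ 2"
    by (intro power_mono norm_diag_mult_vec_le s norm_ge_zero)
  then have "r * (?w \<bullet> ?w) \<le> r * (K\<^sup>2 * (v \<bullet> v))"
    by (intro mult_left_mono) (simp_all add: r power2_norm_eq_inner power_mult_distrib)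
  also have "\<dots> \<le> r' * (v \<bullet> v)"
    using mult_right_mono[OF r(2) inner_ge_zero[of v]] by (simp add: mult_ac)
  finally have "- r' * (v \<bullet> v) \<le> - r * (?w \<bullet> ?w)" by simp
  also have "\<dots> \<le> (diag a *v ?w) \<bullet> (H *v (diag a *v ?w))"
    using H unfolding scaled_loewner_ge_iff by blast
  finally show "- r' * (v \<bullet> v) \<le> (diag b *v v) \<bullet> (H *v (diag b *v v))"
    unfolding w .
qed

lemma infnorm_diag_mult_vec_le_iff:
  "infnorm (diag a *v g) \<le> e \<longleftrightarrow> (\<forall>i. \<bar>a $ i * g $ i\<bar> \<le> e)"
proof
  assume "infnorm (diag a *v g) \<le> e"
  then show "\<forall>i. \<bar>a $ i * g $ i\<bar> \<le> e"
    using component_le_infnorm_cart[of "diag a *v g"] order_trans by fastforce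
next
  assume "\<forall>i. \<bar>a $ i * g $ i\<bar> \<le> e"
  then show "infnorm (diag a *v g) \<le> e"
    unfolding infnorm_cart by (intro cSup_least) auto
qed

section \<open>Constants\<close>

lemma tolerance_factor:
  fixes A B p :: real
  assumes "0 < p"
  obtains c where "0 < c" "A \<le> c" "\<And>\<epsilon>. 0 < \<epsilon> \<Longrightarrow> B * \<epsilon> powr p \<le> (c * \<epsilon>) powr p"
proof
  let ?B = "max B 1"
  let ?c = "max A (?B powr (1 / p))"
  show c: "0 < ?c" "A \<le> ?c" by (auto simp: less_max_iff_disj)
  have "?B = (?B powr (1 / p)) powr p"
    using assms by (simp add: powr_powr)
  also have "\<dots> \<le> ?c powr p"
    using assms by (intro powr_mono2) auto
  finally have "B \<le> ?c powr p" by simp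
  then show "B * \<epsilon> powr p \<le> (?c * \<epsilon>) powr p" if "0 < \<epsilon>" for \<epsilon>
    using that c by (simp add: powr_mult mult_right_mono)
qed

lemma compact_coordinate_bound:
  fixes \<X> :: "(real ^ 'n) set"
  assumes "compact \<X>"
  obtains M where "1 \<le> M" "\<And>x i. x \<in> \<X> \<Longrightarrow> \<bar>x $ i\<bar> \<le> M"
proof -
  obtain N where "\<And>x. x \<in> \<X> \<Longrightarrow> norm x \<le> N"
    using compact_imp_bounded[OF assms] by (auto simp: bounded_iff)
  then have "\<bar>x $ i\<bar> \<le> max N 1" if "x \<in> \<X>" for x i
    using that component_le_norm_cart[of x i] by (smt (verit))
  then show ?thesis using that[of "max N 1"] by simp
qed

lemma ess_strongerI:
  assumes "0 < c"
    and "\<And>\<epsilon> x. 0 < \<epsilon> \<Longrightarrow> x \<in> \<X> \<Longrightarrow> A \<epsilon> p x \<Longrightarrow> B (c * \<epsilon>) p x"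
  shows "ess_stronger \<X> p A B"
  unfolding ess_stronger_def using assms by (intro exI[of _ 1] exI[of _ c]) auto

lemma ess_stronger_weaken:
  assumes "ess_stronger \<X> p A B" "\<And>\<epsilon> x. B \<epsilon> p x \<Longrightarrow> C \<epsilon> p x"
  shows "ess_stronger \<X> p A C"
  using assms unfolding ess_stronger_def by blast

section \<open>Comparing the scaled conditions\<close>

lemma Def3_imp_Def4:
  assumes "Def3 f \<epsilon> p x"
  shows "Def4 f \<epsilon> p x"
proof -
  have x: "0 \<le> x $ i" for i
    using assms by (simp add: Def3_def nonneg_orthant_def)
  have g: "\<bar>x $ i * gradient f x $ i\<bar> \<le> \<epsilon>" for i
    using assms by (simp add: Def3_def infnorm_diag_mult_vec_le_iff)
  have "\<bar>capped x $ i * gradient f x $ i\<bar> \<le> \<epsilon>" for i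
  proof -
    have "\<bar>capped x $ i * gradient f x $ i\<bar> \<le> \<bar>x $ i * gradient f x $ i\<bar>"
      using x[of i] by (simp add: abs_mult capped_def mult_right_mono)
    with g[of i] show ?thesis by linarith
  qed
  moreover have "diag (capped x) ** hessian f x ** diag (capped x) \<succeq> mat (- (\<epsilon> powr p))"
  proof (rule curvature_rescale[where K = 1])
    show "diag x ** hessian f x ** diag x \<succeq> mat (- (\<epsilon> powr p))"
      using assms by (simp add: Def3_def)
    fix i
    let ?s = "\<chi> i. if x $ i \<le> 1 then 1 else 1 / x $ i"
    show "capped x $ i = x $ i * ?s $ i" "\<bar>?s $ i\<bar> \<le> 1"
      by (auto simp: capped_def min_def field_simps)
  qed auto
  ultimately show ?thesis
    using assms by (simp add: Def3_def Def4_def infnorm_diag_mult_vec_le_iff)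
qed

lemma Def4_ess_stronger_Def3:
  assumes "compact \<X>" "0 < p"
  shows "ess_stronger \<X> p (Def4 f) (Def3 f)"
proof -
  obtain M where M: "1 \<le> M" "\<And>x i. x \<in> \<X> \<Longrightarrow> \<bar>x $ i\<bar> \<le> M"
    using compact_coordinate_bound[OF assms(1)] by blast
  obtain c where c: "0 < c" "M \<le> c"
    "\<And>\<epsilon>. 0 < \<epsilon> \<Longrightarrow> M\<^sup>2 * \<epsilon> powr p \<le> (c * \<epsilon>) powr p"
    using tolerance_factor[OF assms(2)] by blast
  show ?thesis
  proof (rule ess_strongerI)
    fix \<epsilon> x assume \<epsilon>: "0 < (\<epsilon>::real)" and xX: "x \<in> \<X>" and D: "Def4 f \<epsilon> p x"
    have x: "0 \<le> x $ i" for i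
      using D by (simp add: Def4_def nonneg_orthant_def)
    have Me: "\<epsilon> \<le> c * \<epsilon>" "M * \<epsilon> \<le> c * \<epsilon>"
      using M(1) c(2) \<epsilon> by auto
    let ?s = "\<chi> i. max (x $ i) 1"
    have s: "x $ i = capped x $ i * ?s $ i" "\<bar>?s $ i\<bar> \<le> M" for i
      using M(1) M(2)[OF xX, of i] by (auto simp: capped_def min_def max_def)
    have "- (c * \<epsilon>) \<le> gradient f x $ i" for i
      using D Me by (force simp: Def4_def intro: order_trans[of _ "- \<epsilon>"])
    moreover have "\<bar>x $ i * gradient f x $ i\<bar> \<le> c * \<epsilon>" for i
    proof -
      have "\<bar>x $ i * gradient f x $ i\<bar> = \<bar>?s $ i\<bar> * \<bar>capped x $ i * gradient f x $ i\<bar>"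
        by (subst s(1)) (simp add: abs_mult)
      also have "\<dots> \<le> M * \<epsilon>"
        using D s(2)[of i] M(1)
        by (intro mult_mono) (auto simp: Def4_def infnorm_diag_mult_vec_le_iff)
      finally show ?thesis using Me by simp
    qed
    moreover have "diag x ** hessian f x ** diag x \<succeq> mat (- ((c * \<epsilon>) powr p))"
      using D by (intro curvature_rescale[OF _ s _ c(3)[OF \<epsilon>]]) (auto simp: Def4_def)
    ultimately show "Def3 f (c * \<epsilon>) p x"
      using D by (simp add: Def4_def Def3_def infnorm_diag_mult_vec_le_iff)
  qed (rule c)
qed

lemma Def3_imp_Def5: "Def3 f \<epsilon> p x \<Longrightarrow> Def5 f \<epsilon> p x"
  by (simp add: Def3_def Def5_def)

lemma Def1_ess_stronger_Def5:
  assumes "compact \<X>" "0 < p"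
  shows "ess_stronger \<X> p (Def1 f) (Def5 f)"
proof -
  obtain M where M: "1 \<le> M" "\<And>x i. x \<in> \<X> \<Longrightarrow> \<bar>x $ i\<bar> \<le> M"
    using compact_coordinate_bound[OF assms(1)] by blast
  obtain c where c: "0 < c" "2 * M \<le> c"
    "\<And>\<epsilon>. 0 < \<epsilon> \<Longrightarrow> M\<^sup>2 * \<epsilon> powr p \<le> (c * \<epsilon>) powr p"
    using tolerance_factor[OF assms(2)] by blast
  show ?thesis
  proof (rule ess_strongerI)
    fix \<epsilon> x assume \<epsilon>: "0 < (\<epsilon>::real)" and xX: "x \<in> \<X>" and D: "Def1 f \<epsilon> p x"
    \<comment> \<open>The scaling of \<open>Def1\<close> lacks exactly the factors \<open>x $ i\<close> of the coordinates outside \<open>?J\<close>.\<close>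
    let ?J = "small_coords \<epsilon> x"
    let ?a = "\<chi> i. if i \<in> ?J then x $ i else 1"
    let ?s = "\<chi> i. if i \<in> ?J then 1 else x $ i"
    have s: "x $ i = ?a $ i * ?s $ i" "\<bar>?s $ i\<bar> \<le> M" for i
      using M(1) M(2)[OF xX, of i] by auto
    have "\<bar>x $ i * gradient f x $ i\<bar> \<le> c * \<epsilon>" for i
    proof -
      have "\<bar>x $ i * gradient f x $ i\<bar> = \<bar>?s $ i\<bar> * \<bar>(diag ?a *v gradient f x) $ i\<bar>"
        by (simp add: abs_mult)
      also have "\<dots> \<le> M * (2 * \<epsilon>)"
        using D s(2)[of i] M(1) component_le_norm_cart[of "diag ?a *v gradient f x" i]
        unfolding Def1_def scaling1_def by (intro mult_mono) linarith+
      also have "\<dots> \<le> c * \<epsilon>"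
        using mult_right_mono[OF c(2), of \<epsilon>] \<epsilon> by simp
      finally show ?thesis .
    qed
    moreover have "diag x ** hessian f x ** diag x \<succeq> mat (- ((c * \<epsilon>) powr p))"
      using D by (intro curvature_rescale[OF _ s _ c(3)[OF \<epsilon>]]) (auto simp: Def1_def scaling1_def)
    ultimately show "Def5 f (c * \<epsilon>) p x"
      using D by (simp add: Def1_def Def5_def infnorm_diag_mult_vec_le_iff)
  qed (rule c)
qed

section \<open>Testing the models of the objective at feasible steps\<close>

lemma compact_feasible_steps: "compact (feasible_steps x \<Delta>)"
proof -
  have "feasible_steps x \<Delta> = cball 0 \<Delta> \<inter> (\<Inter>i. {d. 0 \<le> x $ i + d $ i})"
    by (auto simp: feasible_steps_def nonneg_orthant_def)
  moreover have "closed (\<Inter>i. {d. 0 \<le> x $ i + d $ i})"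
    by (intro closed_INT ballI closed_Collect_le continuous_intros)
  ultimately show ?thesis by (simp add: compact_Int_closed)
qed

lemma min_value_feasible_le:
  assumes "continuous_on UNIV q" "d \<in> feasible_steps x \<Delta>"
  shows "min_value (feasible_steps x \<Delta>) q \<le> q d"
proof -
  have "continuous_on (feasible_steps x \<Delta>) q"
    using assms(1) by (rule continuous_on_subset) simp
  then show ?thesis
    using min_value_attained[OF compact_feasible_steps] assms(2) by fastforce
qed

text \<open>
  It suffices to bound the curvature along unit vectors. Choosing \<open>t = min 1 (\<Delta> / M)\<close> makes
  \<open>\<Delta> / t = max \<Delta> M\<close>, and this stays bounded as \<open>\<Delta>\<close> tends to \<open>0\<close>.
\<close>
lemma quadratic_model_curvature:
  fixes g x :: "real ^ 'n"
  assumes x: "\<And>i. 0 \<le> x $ i" "\<And>i. x $ i \<le> M" and M: "1 \<le> M"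
    and \<Delta>: "0 < \<Delta>" and r: "0 \<le> r"
    and model: "\<And>d. d \<in> feasible_steps x \<Delta> \<Longrightarrow>
      - (\<Delta>\<^sup>2 * r) \<le> g \<bullet> d + 1/2 * (d \<bullet> (H *v d))"
  shows "diag x ** H ** diag x \<succeq> mat (- (2 * (max \<Delta> M)\<^sup>2 * r))"
  unfolding scaled_loewner_ge_iff
proof
  fix v :: "real ^ 'n"
  let ?q = "\<lambda>u. (diag x *v u) \<bullet> (H *v (diag x *v u))"
  have unit: "- (2 * (max \<Delta> M)\<^sup>2 * r) \<le> ?q u" if "norm u = 1" for u
  proof -
    define \<sigma> :: real where "\<sigma> = (if g \<bullet> (diag x *v u) \<le> 0 then 1 else - 1)"
    define t where "t = min 1 (\<Delta> / M)"
    define d where "d = (\<sigma> * t) *\<^sub>R (diag x *v u)"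
    have \<sigma>: "\<bar>\<sigma>\<bar> = 1" "\<sigma> * \<sigma> = 1" "\<sigma> * (g \<bullet> (diag x *v u)) \<le> 0"
      by (auto simp: \<sigma>_def)
    have t: "0 < t" "t \<le> 1" "t * M \<le> \<Delta>"
      using M \<Delta> by (auto simp: t_def min_def field_simps)
    have small: "\<bar>\<sigma> * t * u $ i\<bar> \<le> 1" for i
    proof -
      have "t * \<bar>u $ i\<bar> \<le> 1 * 1"
        using t component_le_norm_cart[of u i] that by (intro mult_mono) auto
      then show ?thesis using t \<sigma>(1) by (simp add: abs_mult)
    qed
    then have "0 \<le> x $ i * (1 + \<sigma> * t * u $ i)" for i
    proof -
      have "0 \<le> 1 + \<sigma> * t * u $ i" using small[of i] by linarith
      then show ?thesis using x(1) by simp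
    qed
    then have "x + d \<in> nonneg_orthant"
      by (simp add: nonneg_orthant_def d_def algebra_simps)
    moreover have "norm d \<le> \<Delta>"
    proof -
      have "norm d = t * norm (diag x *v u)"
        using t \<sigma>(1) by (simp add: d_def abs_mult)
      also have "\<dots> \<le> t * (M * norm u)"
        using x t by (intro mult_left_mono norm_diag_mult_vec_le) auto
      finally show ?thesis using t that by simp
    qed
    ultimately have "- (\<Delta>\<^sup>2 * r) \<le> g \<bullet> d + 1/2 * (d \<bullet> (H *v d))"
      by (intro model) (simp add: feasible_steps_def)
    moreover have "g \<bullet> d \<le> 0"
      using \<sigma>(3) t by (simp add: d_def mult.assoc mult.left_commute[of _ t] mult_nonneg_nonpos)
    moreover have "d \<bullet> (H *v d) = t\<^sup>2 * ?q u"
    proof -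
      have "d \<bullet> (H *v d) = (\<sigma> * \<sigma>) * (t * t) * ?q u"
        unfolding d_def by (simp add: matrix_vector_mult_scaleR mult_ac)
      then show ?thesis using \<sigma> by (simp add: power2_eq_square)
    qed
    ultimately have *: "- (2 * \<Delta>\<^sup>2 * r) \<le> t\<^sup>2 * ?q u" by simp
    have "t * max \<Delta> M = \<Delta>"
      using M \<Delta> by (auto simp: t_def min_def max_def field_simps)
    then have "t\<^sup>2 * (max \<Delta> M)\<^sup>2 = \<Delta>\<^sup>2"
      by (metis power_mult_distrib)
    then have "t\<^sup>2 * (- (2 * (max \<Delta> M)\<^sup>2 * r)) = - (2 * \<Delta>\<^sup>2 * r)"
      by algebra
    with * have "t\<^sup>2 * (- (2 * (max \<Delta> M)\<^sup>2 * r)) \<le> t\<^sup>2 * ?q u" by (simp only:)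
    then show ?thesis using t(1) by (simp only: mult_le_cancel_left_pos zero_less_power)
  qed
  show "- (2 * (max \<Delta> M)\<^sup>2 * r) * (v \<bullet> v) \<le> ?q v"
  proof (cases "v = 0")
    case False
    define u where "u = v /\<^sub>R norm v"
    have u: "norm u = 1" "v = norm v *\<^sub>R u"
      using False by (simp_all add: u_def)
    have "- (2 * (max \<Delta> M)\<^sup>2 * r) * (v \<bullet> v) \<le> ?q u * (v \<bullet> v)"
      by (intro mult_right_mono unit u) simp
    also have "\<dots> = ?q (norm v *\<^sub>R u)"
      by (simp add: matrix_vector_mult_scaleR dot_square_norm power2_eq_square mult_ac)
    finally show ?thesis by (simp only: flip: u(2))
  qed simp
qed

lemma Def2_ess_stronger_Def3:
  assumes "compact \<X>" "0 < p"
  shows "ess_stronger \<X> p (Def2 \<Delta>max f) (Def3 f)"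
proof -
  obtain M where M: "1 \<le> M" "\<And>x i. x \<in> \<X> \<Longrightarrow> \<bar>x $ i\<bar> \<le> M"
    using compact_coordinate_bound[OF assms(1)] by blast
  define K where "K = max \<Delta>max M"
  obtain c where c: "0 < c" "K \<le> c"
    "\<And>\<epsilon>. 0 < \<epsilon> \<Longrightarrow> (2 * K\<^sup>2) * \<epsilon> powr p \<le> (c * \<epsilon>) powr p"
    using tolerance_factor[OF assms(2)] by blast
  show ?thesis
  proof (rule ess_strongerI)
    fix \<epsilon> x assume \<epsilon>: "0 < (\<epsilon>::real)" and xX: "x \<in> \<X>" and D: "Def2 \<Delta>max f \<epsilon> p x"
    let ?g = "gradient f x" and ?H = "hessian f x"
    have x: "0 \<le> x $ i" "x $ i \<le> M" for i
      using D M(2)[OF xX, of i] by (auto simp: Def2_def nonneg_orthant_def)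
    obtain \<Delta> where \<Delta>: "0 < \<Delta>" "\<Delta> \<le> \<Delta>max"
      and lin: "\<bar>min_value (feasible_steps x \<Delta>) (\<lambda>d. ?g \<bullet> d)\<bar> \<le> \<Delta> * \<epsilon>"
      and quad: "\<bar>min_value (feasible_steps x \<Delta>)
         (\<lambda>d. ?g \<bullet> d + 1/2 * (d \<bullet> (?H *v d)))\<bar> \<le> \<Delta>\<^sup>2 * \<epsilon> powr p"
      using D unfolding Def2_def by blast
    have lin_le: "- (\<Delta> * \<epsilon>) \<le> ?g \<bullet> d" if "d \<in> feasible_steps x \<Delta>" for d
    proof -
      have "continuous_on UNIV (\<lambda>d. ?g \<bullet> d)" by (intro continuous_intros)
      from min_value_feasible_le[OF this that] lin show ?thesis by linarith
    qed
    have quad_le: "- (\<Delta>\<^sup>2 * \<epsilon> powr p) \<le> ?g \<bullet> d + 1/2 * (d \<bullet> (?H *v d))"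
      if "d \<in> feasible_steps x \<Delta>" for d
    proof -
      have "continuous_on UNIV (\<lambda>d. ?g \<bullet> d + 1/2 * (d \<bullet> (?H *v d)))"
        by (intro continuous_intros matrix_vector_mult_linear_continuous_on)
      from min_value_feasible_le[OF this that] quad show ?thesis by linarith
    qed
    have K: "1 \<le> K" "M \<le> K" "\<Delta> \<le> K"
      using M(1) \<Delta> by (auto simp: K_def)
    have Ke: "K * \<epsilon> \<le> c * \<epsilon>" "\<epsilon> \<le> K * \<epsilon>"
      using c(2) K(1) \<epsilon> by auto
    \<comment> \<open>Used with \<open>a = \<Delta>\<close> for the lower gradient bound, and with \<open>a = - min (x $ i) \<Delta>\<close> for
      complementarity.\<close>
    have axis_step: "- (\<Delta> * \<epsilon>) \<le> a * ?g $ i" if "0 \<le> x $ i + a" "\<bar>a\<bar> \<le> \<Delta>" for a i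
    proof -
      have "norm (axis i a) = \<bar>a\<bar>"
        by (simp add: norm_eq_sqrt_inner inner_axis_axis)
      moreover have "x + axis i a \<in> nonneg_orthant"
        using that x(1) by (auto simp: nonneg_orthant_def axis_def)
      ultimately show ?thesis
        using lin_le[of "axis i a"] that by (simp add: feasible_steps_def inner_axis mult.commute)
    qed
    have g_ge: "- \<epsilon> \<le> ?g $ i" for i
    proof -
      have "\<Delta> * (- \<epsilon>) \<le> \<Delta> * ?g $ i"
        using axis_step[of i \<Delta>] x(1)[of i] \<Delta> by simp
      then show ?thesis using \<Delta>(1) by (simp only: mult_le_cancel_left_pos)
    qed
    have xg_le: "x $ i * ?g $ i \<le> K * \<epsilon>" for i
    proof (cases "x $ i \<le> \<Delta>")
      case True
      then have "x $ i * ?g $ i \<le> \<Delta> * \<epsilon>"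
        using axis_step[of i "- x $ i"] x(1)[of i] by simp
      also have "\<dots> \<le> K * \<epsilon>" using K \<epsilon> by simp
      finally show ?thesis .
    next
      case False
      then have "\<Delta> * ?g $ i \<le> \<Delta> * \<epsilon>"
        using axis_step[of i "- \<Delta>"] \<Delta>(1) by simp
      then have "?g $ i \<le> \<epsilon>" using \<Delta>(1) by simp
      then have "x $ i * ?g $ i \<le> x $ i * \<epsilon>" using x(1) by (rule mult_left_mono)
      also have "\<dots> \<le> K * \<epsilon>" using K x(2)[of i] \<epsilon> by simp
      finally show ?thesis .
    qed
    have xg_ge: "- (K * \<epsilon>) \<le> x $ i * ?g $ i" for i
    proof -
      have "- (K * \<epsilon>) \<le> x $ i * (- \<epsilon>)" using K x(2)[of i] \<epsilon> by simp
      also have "\<dots> \<le> x $ i * ?g $ i" using g_ge x(1) by (rule mult_left_mono)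
      finally show ?thesis .
    qed
    \<comment> \<open>The radius \<open>\<Delta>\<close> depends on \<open>x\<close> and \<open>\<epsilon>\<close>; only its bound \<open>\<Delta>max\<close> may enter the constant.\<close>
    have curv: "diag x ** ?H ** diag x \<succeq> mat (- (2 * (max \<Delta> M)\<^sup>2 * \<epsilon> powr p))"
      using x M(1) \<Delta>(1) _ quad_le by (rule quadratic_model_curvature) simp
    have le: "1\<^sup>2 * (2 * (max \<Delta> M)\<^sup>2 * \<epsilon> powr p) \<le> (c * \<epsilon>) powr p"
    proof -
      have "(max \<Delta> M)\<^sup>2 \<le> K\<^sup>2"
        using K \<Delta>(1) by (intro power_mono) auto
      then have "2 * (max \<Delta> M)\<^sup>2 * \<epsilon> powr p \<le> (2 * K\<^sup>2) * \<epsilon> powr p"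
        by (intro mult_right_mono) auto
      with c(3)[OF \<epsilon>] show ?thesis by simp
    qed
    have "diag x ** ?H ** diag x \<succeq> mat (- ((c * \<epsilon>) powr p))"
      by (rule curvature_rescale[OF curv _ _ _ le, where s = 1]) auto
    moreover have "\<bar>x $ i * ?g $ i\<bar> \<le> c * \<epsilon>" for i
      using xg_le[of i] xg_ge[of i] Ke by linarith
    moreover have "- (c * \<epsilon>) \<le> ?g $ i" for i
      using g_ge[of i] Ke by linarith
    ultimately show "Def3 f (c * \<epsilon>) p x"
      using D by (simp add: Def2_def Def3_def infnorm_diag_mult_vec_le_iff)
  qed (rule c)
qed

theorem theorem2:
  fixes f :: "real ^ 'n \<Rightarrow> real" and \<X> :: "(real ^ 'n) set" and p \<Delta>max :: real
  assumes "C2 f"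
    and "bdd_below (f ` nonneg_orthant)"
    and "compact \<X>"
    and "p > 0"
    and "\<Delta>max > 0"
  shows "ess_stronger \<X> p (Def2 \<Delta>max f) (Def3 f) \<and>
         ess_equivalent \<X> p (Def3 f) (Def4 f) \<and>
         ess_stronger \<X> p (Def4 f) (Def5 f) \<and>
         ess_stronger \<X> p (Def1 f) (Def5 f)"
proof (intro conjI)
  note pX = \<open>compact \<X>\<close> \<open>p > 0\<close>
  show "ess_stronger \<X> p (Def2 \<Delta>max f) (Def3 f)"
    by (rule Def2_ess_stronger_Def3[OF pX])
  have "ess_stronger \<X> p (Def3 f) (Def4 f)"
    by (rule ess_strongerI[where c = 1]) (auto intro: Def3_imp_Def4)
  with Def4_ess_stronger_Def3[OF pX] show "ess_equivalent \<X> p (Def3 f) (Def4 f)"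
    by (simp add: ess_equivalent_def)
  show "ess_stronger \<X> p (Def4 f) (Def5 f)"
    using Def4_ess_stronger_Def3[OF pX] Def3_imp_Def5 by (rule ess_stronger_weaken)
  show "ess_stronger \<X> p (Def1 f) (Def5 f)"
    by (rule Def1_ess_stronger_Def5[OF pX])
qed

end
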